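(* Let $(\Omega,\mathcal{F}_2,\mathbb{P})$ be a probability space and let $\mathcal{F}_1\subset\mathcal{F}_2$ be a sub-sigma-algebra such that $\mathcal{F}_2$ is atomless conditionally to $\mathcal{F}_1$. Then for any two integrable $\mathcal{F}_1$-measurable random variables $f,g\colon\Omega\to\mathbb{R}$ there exist two commonotone, integrable, $\mathcal{F}_2$-measurable random variables $\xi,\eta\colon\Omega\to\mathbb{R}$ such that $$f=\mathbb{E}[\xi\mid\mathcal{F}_1]\quad\text{and}\quad g=\mathbb{E}[\eta\mid\mathcal{F}_1]\quad\text{almost surely},$$ and such that, almost surely, $$\Vert(\xi,\eta)\Vert\le\max\bigl(2\Vert(f,g)\Vert,\,1\bigr),$$ where $\Vert\cdot\Vert$ is the norm on $\mathbb{R}^2$ whose closed unit ball is the parallelogram $P_1$ with vertices $(-4,-4),(-4,-2),(4,4),(4,2)$.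
   Context: Random variables are considered modulo almost sure equality. Conditional atomlessness: $\mathcal{F}_2$ is atomless conditionally to $\mathcal{F}_1$ if for every $A\in\mathcal{F}_2$ there exists a set $B\subset A$, $B\in\mathcal{F}_2$, such that $0<\mathbb{E}[\mathbf{1}_B\mid\mathcal{F}_1]<\mathbb{E}[\mathbf{1}_A\mid\mathcal{F}_1]$ (almost surely) on the set $\{\mathbb{E}[\mathbf{1}_A\mid\mathcal{F}_1]>0\}$. Commonotonicity: two random variables $\xi,\eta$ are commonotone if there are two nondecreasing functions $\phi,\psi\colon\mathbb{R}\to\mathbb{R}$ and a random variable $\zeta$ such that $\xi=\phi(\zeta)$ and $\eta=\psi(\zeta)$ (almost surely). The norm: $P_1\subset\mathbb{R}^2$ is the convex hull of the two vertical segments joining $(-4,-4)$ to $(-4,-2)$ and $(4,2)$ to $(4,4)$. It is convex, compact and symmetric around the origin, and $\Vert\cdot\Vert$ is the norm on $\mathbb{R}^2$ determined by $\Vert(x,y)\Vert\le 1$ if and only if $(x,y)\in P_1$; explicitly $\Vert(x,y)\Vert=\max\bigl(|x|/4,\;|y-\tfrac34x|\bigr)$. *)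

theory Defs
  imports "HOL-Probability.Probability"
begin

text \<open>
  The probability space is \<open>M\<close>, whose measurable sets form the larger sigma-algebra; the
  sub-sigma-algebra is carried by a measure \<open>F\<close> with \<^term>\<open>subalgebra M F\<close>, of which only the
  measurable sets are used.
\<close>

definition conditionally_atomless :: "'a measure \<Rightarrow> 'a measure \<Rightarrow> bool" where
  "conditionally_atomless M F \<longleftrightarrow>
    (\<forall>A\<in>sets M. \<exists>B\<in>sets M. B \<subseteq> A \<and>
      (AE x in M. real_cond_exp M F (indicator A) x > 0 \<longrightarrow>
         0 < real_cond_exp M F (indicator B) x \<and>
         real_cond_exp M F (indicator B) x < real_cond_exp M F (indicator A) x))"

definition commonotone :: "'a measure \<Rightarrow> ('a \<Rightarrow> real) \<Rightarrow> ('a \<Rightarrow> real) \<Rightarrow> bool" where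
  "commonotone M \<xi> \<eta> \<longleftrightarrow>
    (\<exists>(\<phi> :: real \<Rightarrow> real) (\<psi> :: real \<Rightarrow> real) \<zeta>. mono \<phi> \<and> mono \<psi> \<and> \<zeta> \<in> borel_measurable M \<and>
       (AE x in M. \<xi> x = \<phi> (\<zeta> x)) \<and> (AE x in M. \<eta> x = \<psi> (\<zeta> x)))"

definition P1 :: "(real \<times> real) set" where
  "P1 = convex hull (closed_segment (-4, -4) (-4, -2) \<union> closed_segment (4, 2) (4, 4))"

text \<open>
  The norm with closed unit ball \<^const>\<open>P1\<close>, as its Minkowski gauge. The facts below show that this
  is a norm, that its closed unit ball is \<^const>\<open>P1\<close>, and give its explicit value.
\<close>

definition P1_norm :: "real \<times> real \<Rightarrow> real" where
  "P1_norm v = Inf {r. r > 0 \<and> v \<in> (*\<^sub>R) r ` P1}"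

lemma P1_eq: "P1 = {(x, y). \<bar>x\<bar> \<le> 4 \<and> \<bar>y - 3/4 * x\<bar> \<le> 1}" (is "_ = ?S")
proof
  have "?S = {v. (1, 0) \<bullet> v \<le> 4} \<inter> {v. (-1, 0) \<bullet> v \<le> 4}
      \<inter> {v. (-3/4, 1) \<bullet> v \<le> 1} \<inter> {v. (3/4, -1) \<bullet> v \<le> (1::real)}"
    by (auto simp: abs_le_iff)
  then have "convex ?S"
    by (simp only:) (intro convex_Int convex_halfspace_le)
  moreover have "{(-4, -4), (-4, -2), (4, 2), (4, 4)} \<subseteq> ?S"
    by auto
  ultimately have "closed_segment (-4, -4) (-4, -2) \<union> closed_segment (4, 2) (4, 4) \<subseteq> ?S"
    by (intro Un_least closed_segment_subset) auto
  with \<open>convex ?S\<close> show "P1 \<subseteq> ?S"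
    unfolding P1_def by (intro hull_minimal)
next
  show "?S \<subseteq> P1"
  proof clarify
    fix x y :: real assume "\<bar>x\<bar> \<le> 4" and "\<bar>y - 3/4 * x\<bar> \<le> 1"
    define c where "c = y - 3/4 * x"
    define t where "t = (x + 4) / 8"
    define s where "s = (c + 1) / 2"
    have t: "0 \<le> t" "t \<le> 1" and s: "0 \<le> s" "s \<le> 1"
      using \<open>\<bar>x\<bar> \<le> 4\<close> \<open>\<bar>y - 3/4 * x\<bar> \<le> 1\<close> by (auto simp: t_def s_def c_def abs_le_iff)
    have "(-4 :: real, c - 3) \<in> closed_segment (-4, -4) (-4, -2)"
      unfolding in_segment using s by (intro exI[of _ s]) (simp add: s_def field_simps)
    then have "(-4, c - 3) \<in> P1"
      unfolding P1_def by (intro hull_inc UnI1)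
    moreover have "(4 :: real, c + 3) \<in> closed_segment (4, 2) (4, 4)"
      unfolding in_segment using s by (intro exI[of _ s]) (simp add: s_def field_simps)
    then have "(4, c + 3) \<in> P1"
      unfolding P1_def by (intro hull_inc UnI2)
    moreover have "convex P1"
      unfolding P1_def by (rule convex_convex_hull)
    ultimately have "(1 - t) *\<^sub>R (-4, c - 3) + t *\<^sub>R (4, c + 3) \<in> P1"
      using t by (intro convexD) auto
    moreover have "(1 - t) *\<^sub>R (-4, c - 3) + t *\<^sub>R (4, c + 3) = (x, y)"
      by (simp add: t_def c_def field_simps)
    ultimately show "(x, y) \<in> P1"
      by simp
  qed
qed

lemma P1_norm_eq: "P1_norm (x, y) = max (\<bar>x\<bar> / 4) \<bar>y - 3/4 * x\<bar>"
proof -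
  define m where "m = max (\<bar>x\<bar> / 4) \<bar>y - 3/4 * x\<bar>"
  have "m \<ge> 0"
    by (simp add: m_def)
  have *: "(x, y) \<in> (*\<^sub>R) r ` P1 \<longleftrightarrow> m \<le> r" if "r > 0" for r
  proof -
    have "(x, y) \<in> (*\<^sub>R) r ` P1 \<longleftrightarrow> (x / r, y / r) \<in> P1"
    proof
      assume "(x / r, y / r) \<in> P1"
      moreover have "(x, y) = r *\<^sub>R (x / r, y / r)"
        using that by simp
      ultimately show "(x, y) \<in> (*\<^sub>R) r ` P1"
        by blast
    qed (use that in auto)
    also have "y / r - 3/4 * (x / r) = (y - 3/4 * x) / r"
      by (simp add: diff_divide_distrib)
    then have "(x / r, y / r) \<in> P1 \<longleftrightarrow> \<bar>x / r\<bar> \<le> 4 \<and> \<bar>(y - 3/4 * x) / r\<bar> \<le> 1"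
      unfolding P1_eq by (simp only: mem_Collect_eq case_prod_conv)
    also have "\<dots> \<longleftrightarrow> m \<le> r"
      using that by (simp add: m_def pos_divide_le_eq mult.commute)
    finally show ?thesis .
  qed
  then have set_eq: "{r. r > 0 \<and> (x, y) \<in> (*\<^sub>R) r ` P1} = {r. r > 0 \<and> m \<le> r}"
    by blast
  have "Inf {r. r > 0 \<and> m \<le> r} = m"
  proof (cases "m = 0")
    case True
    then have "{r. r > 0 \<and> m \<le> r} = {0<..}"
      by auto
    then show ?thesis
      using True by simp
  next
    case False
    with \<open>m \<ge> 0\<close> have "{r. r > 0 \<and> m \<le> r} = {m..}"
      by auto
    then show ?thesis
      by simp
  qed
  then show ?thesis
    unfolding P1_norm_def set_eq by (simp add: m_def)
qed

lemma P1_norm_le_1_iff: "P1_norm v \<le> 1 \<longleftrightarrow> v \<in> P1"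
  by (cases v) (auto simp: P1_norm_eq P1_eq)

lemma P1_norm_nonneg: "0 \<le> P1_norm v"
  by (cases v) (simp add: P1_norm_eq le_max_iff_disj)

lemma P1_norm_eq_0_iff: "P1_norm v = 0 \<longleftrightarrow> v = 0"
  by (cases v) (auto simp: P1_norm_eq max_def zero_prod_def split: if_splits)

lemma P1_norm_scaleR: "P1_norm (c *\<^sub>R v) = \<bar>c\<bar> * P1_norm v"
proof (cases v)
  case (Pair x y)
  have "c * y - 3/4 * (c * x) = c * (y - 3/4 * x)"
    by (simp add: algebra_simps)
  then show ?thesis
    by (simp add: Pair P1_norm_eq abs_mult max_mult_distrib_left)
qed

lemma P1_norm_triangle: "P1_norm (v + w) \<le> P1_norm v + P1_norm w"
  by (cases v, cases w) (auto simp: P1_norm_eq max_def abs_if field_simps)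

end

theory Submission
  imports Defs
begin

text \<open>
  The vertices of all the dilations \<open>2\<^sup>n P\<^sub>1\<close>, \<open>n \<ge> 0\<close>, form a chain for the componentwise order of the
  plane, so any two random variables \<open>\<xi>\<close>, \<open>\<eta>\<close> for which \<open>(\<xi>, \<eta>)\<close> takes values among them are commonotone.
  For the least \<open>s = 2\<^sup>n\<close> with \<open>\<parallel>(f, g)\<parallel> \<le> s\<close>, the point \<open>(f, g)\<close> is a barycentre of the vertices of \<open>s P\<^sub>1\<close>.
  These are \<open>(4 s a, 3 s a + s b)\<close> with signs \<open>a\<close>, \<open>b\<close>, so it suffices to choose random signs with
  \<open>E[s a | F\<^sub>1] = f / 4\<close> and \<open>E[s b | F\<^sub>1] = g - 3/4 f\<close>; no independence is needed. Conditional
  atomlessness provides them, by a conditional form of Sierpinski's theorem on the range of an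
  atomless measure.
\<close>

section \<open>Exhaustion: sets of maximal measure\<close>

text \<open>Greedy choice: each \<open>B (Suc n)\<close> comes within \<open>1 / Suc n\<close> of
  the supremum of the measures of members above \<open>B n\<close>. A member \<open>C\<close> above
  the union lies above every \<open>B n\<close>, so it exceeds the union in measure by less than
  \<open>1 / Suc n\<close> for all \<open>n\<close>.\<close>

lemma (in finite_measure) exists_measure_maximal:
  assumes sub: "\<B> \<subseteq> sets M" and ne: "\<B> \<noteq> {}"
    and chain: "\<And>B. range B \<subseteq> \<B> \<Longrightarrow> incseq B \<Longrightarrow> (\<Union>n::nat. B n) \<in> \<B>"
  shows "\<exists>B\<in>\<B>. \<forall>C\<in>\<B>. B \<subseteq> C \<longrightarrow> measure M C = measure M B"
proof -
  define S where "S B = Sup (measure M ` {C \<in> \<B>. B \<subseteq> C})" for B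
  have bdd: "bdd_above (measure M ` {C \<in> \<B>. B \<subseteq> C})" for B
    by (intro bdd_aboveI2[where M = "measure M (space M)"] bounded_measure)
  have S_ge: "measure M C \<le> S B" if "C \<in> \<B>" "B \<subseteq> C" for B C
    unfolding S_def using that bdd by (intro cSup_upper) auto
  have step: "\<exists>C. C \<in> \<B> \<and> (B \<subseteq> C \<and> S B - 1 / Suc n < measure M C)" if "B \<in> \<B>" for B n
  proof -
    have "\<exists>y\<in>measure M ` {C \<in> \<B>. B \<subseteq> C}. S B - 1 / Suc n < y"
      unfolding S_def using that by (intro less_cSupD) auto
    then show ?thesis by auto
  qed
  have "\<exists>B. \<forall>n. B n \<in> \<B> \<and> (B n \<subseteq> B (Suc n) \<and> S (B n) - 1 / Suc n < measure M (B (Suc n)))"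
    using ne step by (intro dependent_nat_choice) auto
  then obtain B where B: "\<And>n. B n \<in> \<B>" "\<And>n. B n \<subseteq> B (Suc n)"
    "\<And>n. S (B n) - 1 / Suc n < measure M (B (Suc n))"
    by blast
  have U: "(\<Union>n. B n) \<in> \<B>"
    using B by (intro chain incseq_SucI) auto
  moreover have "measure M C = measure M (\<Union>n. B n)" if C: "C \<in> \<B>" "(\<Union>n. B n) \<subseteq> C" for C
  proof (rule antisym)
    have "measure M C \<le> measure M (\<Union>n. B n) + e" if e: "e > 0" for e
    proof -
      obtain n where n: "1 / Suc n < e"
        using nat_approx_posE[OF e] by auto
      have "measure M C \<le> S (B n)"
        using C by (intro S_ge) auto
      moreover have "measure M (B (Suc n)) \<le> measure M (\<Union>n. B n)"
        using U sub by (intro finite_measure_mono) auto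
      ultimately show ?thesis
        using B(3)[of n] n by linarith
    qed
    then show "measure M C \<le> measure M (\<Union>n. B n)"
      by (rule field_le_epsilon)
    show "measure M (\<Union>n. B n) \<le> measure M C"
      using C sub by (intro finite_measure_mono) auto
  qed
  ultimately show ?thesis by blast
qed

section \<open>Conditional probabilities given the sub-sigma-algebra\<close>

context finite_measure_subalgebra
begin

abbreviation cond_prob_sub :: "'a set \<Rightarrow> 'a \<Rightarrow> real" where
  "cond_prob_sub A \<equiv> real_cond_exp M F (indicator A)"

lemma space_subalg: "space F = space M"
  using subalg by (simp add: subalgebra_def)

lemma sets_subalgD: "D \<in> sets F \<Longrightarrow> D \<in> sets M"
  using subalg by (auto simp: subalgebra_def)

lemma cond_prob_sub_Un:
  assumes [measurable]: "A \<in> sets M" "B \<in> sets M" and "A \<inter> B = {}"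
  shows "AE x in M. cond_prob_sub (A \<union> B) x = cond_prob_sub A x + cond_prob_sub B x"
proof -
  have "indicator (A \<union> B) = (\<lambda>x. indicator A x + indicator B x :: real)"
    using assms(3) by (auto simp: indicator_def fun_eq_iff)
  then show ?thesis
    using real_cond_exp_add[of "indicator A" "indicator B"] by (simp add: emeasure_eq_measure)
qed

lemma cond_prob_sub_mono:
  assumes [measurable]: "A \<in> sets M" "B \<in> sets M" and "A \<subseteq> B"
  shows "AE x in M. cond_prob_sub A x \<le> cond_prob_sub B x"
  using assms(3) by (intro real_cond_exp_mono) (auto simp: indicator_def emeasure_eq_measure)

lemma cond_prob_sub_nonneg:
  assumes [measurable]: "A \<in> sets M"
  shows "AE x in M. 0 \<le> cond_prob_sub A x"
  by (intro real_cond_exp_pos) auto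

text \<open>This localisation is what allows sets to be cut and glued along
  \<open>F\<close>-measurable pieces.\<close>

lemma cond_prob_sub_Int:
  assumes [measurable]: "A \<in> sets M" "D \<in> sets F"
  shows "AE x in M. cond_prob_sub (A \<inter> D) x = indicator D x * cond_prob_sub A x"
proof -
  have [measurable]: "D \<in> sets M" by (rule sets_subalgD) fact
  have "indicator (A \<inter> D) = (\<lambda>x. indicator D x * indicator A x :: real)"
    by (auto simp: indicator_def fun_eq_iff)
  moreover have "integrable M (\<lambda>x. indicator D x * indicator A x :: real)"
    by (rule integrable_const_bound[where B = 1]) (auto simp: indicator_def)
  ultimately show ?thesis
    using real_cond_exp_mult[of "indicator D" "indicator A"] by simp
qed

lemma cond_prob_sub_space: "AE x in M. cond_prob_sub (space M) x = 1"
proof -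
  have "AE x in M. real_cond_exp M F (\<lambda>_. 1) x = 1"
    by (intro real_cond_exp_F_meas) auto
  moreover have "AE x in M. cond_prob_sub (space M) x = real_cond_exp M F (\<lambda>_. 1) x"
    by (intro real_cond_exp_cong) auto
  ultimately show ?thesis by eventually_elim simp
qed

lemma integral_cond_prob_sub:
  assumes [measurable]: "A \<in> sets M"
  shows "integrable M (cond_prob_sub A)" "(\<integral>x. cond_prob_sub A x \<partial>M) = measure M A"
  using real_cond_exp_int[of "indicator A"] by (auto simp: emeasure_eq_measure)

section \<open>Small pieces and the conditional Sierpinski theorem\<close>

text \<open>Of the two pieces \<open>B\<close> and \<open>A - B\<close> given by atomlessness, at
  least one carries at most half of the conditional probability at almost every point. Which one may
  vary, but \<open>D\<close> is \<open>F\<close>-measurable, so \<open>B\<close> on \<open>D\<close>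
  can be glued to \<open>A - B\<close> off \<open>D\<close>. Strictness on both sides keeps either
  piece positive.\<close>

lemma conditionally_atomless_half:
  assumes atomless: "conditionally_atomless M F" and A[measurable]: "A \<in> sets M"
  shows "\<exists>B\<in>sets M. B \<subseteq> A \<and> (AE x in M. 0 < cond_prob_sub A x \<longrightarrow>
    0 < cond_prob_sub B x \<and> cond_prob_sub B x \<le> cond_prob_sub A x / 2)"
proof -
  obtain B where B[measurable]: "B \<in> sets M" and "B \<subseteq> A"
    and AE_B: "AE x in M. 0 < cond_prob_sub A x \<longrightarrow>
         0 < cond_prob_sub B x \<and> cond_prob_sub B x < cond_prob_sub A x"
    using atomless A unfolding conditionally_atomless_def by blast
  define D where "D = {x \<in> space F. cond_prob_sub B x \<le> cond_prob_sub A x / 2}"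
  define D' where "D' = space F - D"
  have DF: "D \<in> sets F" "D' \<in> sets F"
    unfolding D_def D'_def by measurable
  then have [measurable]: "D \<in> sets M" "D' \<in> sets M"
    by (auto intro: sets_subalgD)
  have "B \<union> (A - B) = A"
    using \<open>B \<subseteq> A\<close> by auto
  then have "AE x in M. cond_prob_sub A x = cond_prob_sub B x + cond_prob_sub (A - B) x"
    using cond_prob_sub_Un[of B "A - B"] by auto
  moreover have "AE x in M. cond_prob_sub (B \<inter> D \<union> (A - B) \<inter> D') x
      = cond_prob_sub (B \<inter> D) x + cond_prob_sub ((A - B) \<inter> D') x"
    by (intro cond_prob_sub_Un) auto
  moreover have "AE x in M. cond_prob_sub (B \<inter> D) x = indicator D x * cond_prob_sub B x"
    using DF by (intro cond_prob_sub_Int) auto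
  moreover have "AE x in M. cond_prob_sub ((A - B) \<inter> D') x = indicator D' x * cond_prob_sub (A - B) x"
    using DF by (intro cond_prob_sub_Int) auto
  ultimately have "AE x in M. 0 < cond_prob_sub A x \<longrightarrow>
      0 < cond_prob_sub (B \<inter> D \<union> (A - B) \<inter> D') x \<and>
      cond_prob_sub (B \<inter> D \<union> (A - B) \<inter> D') x \<le> cond_prob_sub A x / 2"
    using AE_B AE_space
  proof eventually_elim
    case (elim x)
    show ?case
    proof (cases "x \<in> D")
      case True
      then have "x \<notin> D'" "cond_prob_sub B x \<le> cond_prob_sub A x / 2"
        by (auto simp: D_def D'_def)
      with True show ?thesis
        using elim by simp
    next
      case False
      with elim have "x \<in> D'" "cond_prob_sub A x / 2 < cond_prob_sub B x"
        by (auto simp: D_def D'_def space_subalg)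
      with False show ?thesis
        using elim by simp
    qed
  qed
  moreover have "B \<inter> D \<union> (A - B) \<inter> D' \<subseteq> A"
    using \<open>B \<subseteq> A\<close> by auto
  ultimately show ?thesis
    by (intro bexI[of _ "B \<inter> D \<union> (A - B) \<inter> D'"]) auto
qed

lemma conditionally_atomless_small:
  assumes atomless: "conditionally_atomless M F" and A: "A \<in> sets M"
  shows "\<exists>B\<in>sets M. B \<subseteq> A \<and> (AE x in M. 0 < cond_prob_sub A x \<longrightarrow>
    0 < cond_prob_sub B x \<and> cond_prob_sub B x \<le> cond_prob_sub A x / 2 ^ n)"
proof (induction n)
  case 0
  show ?case using A by (intro bexI[of _ A]) auto
next
  case (Suc n)
  then obtain B where B: "B \<in> sets M" "B \<subseteq> A"
    and AE_B: "AE x in M. 0 < cond_prob_sub A x \<longrightarrow>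
      0 < cond_prob_sub B x \<and> cond_prob_sub B x \<le> cond_prob_sub A x / 2 ^ n"
    by blast
  obtain C where C: "C \<in> sets M" "C \<subseteq> B"
    and AE_C: "AE x in M. 0 < cond_prob_sub B x \<longrightarrow>
      0 < cond_prob_sub C x \<and> cond_prob_sub C x \<le> cond_prob_sub B x / 2"
    using conditionally_atomless_half[OF atomless B(1)] by blast
  have "AE x in M. 0 < cond_prob_sub A x \<longrightarrow>
      0 < cond_prob_sub C x \<and> cond_prob_sub C x \<le> cond_prob_sub A x / 2 ^ Suc n"
    using AE_B AE_C by eventually_elim auto
  then show ?case
    using B C by (intro bexI[of _ C]) auto
qed

text \<open>The excess \<open>d\<close> over \<open>h\<close> is dominated by the difference of the
  conditional probabilities of the union and of \<open>B n\<close>. The integral of that difference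
  tends to 0 by continuity of the measure from below.\<close>

lemma cond_prob_sub_Union_le:
  assumes B[measurable]: "\<And>n::nat. B n \<in> sets M" and "incseq B"
    and le: "\<And>n. AE x in M. cond_prob_sub (B n) x \<le> h x"
    and [measurable]: "h \<in> borel_measurable M"
  shows "AE x in M. cond_prob_sub (\<Union>n. B n) x \<le> h x"
proof -
  define U where "U = (\<Union>n. B n)"
  have [measurable]: "U \<in> sets M"
    unfolding U_def by measurable
  define d where "d x = max 0 (cond_prob_sub U x - h x)" for x
  have [measurable]: "d \<in> borel_measurable M"
    unfolding d_def by measurable
  have AE_d: "AE x in M. d x \<le> cond_prob_sub U x - cond_prob_sub (B n) x" for n
  proof -
    have "AE x in M. cond_prob_sub (B n) x \<le> cond_prob_sub U x"
      by (intro cond_prob_sub_mono) (auto simp: U_def)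
    then show ?thesis
      using le[of n] by eventually_elim (auto simp: d_def)
  qed
  have int_diff: "integrable M (\<lambda>x. cond_prob_sub U x - cond_prob_sub (B n) x)" for n
    by (intro Bochner_Integration.integrable_diff integral_cond_prob_sub) auto
  have int_d: "integrable M d"
  proof (rule Bochner_Integration.integrable_bound[OF int_diff[of 0]])
    show "AE x in M. norm (d x) \<le> norm (cond_prob_sub U x - cond_prob_sub (B 0) x)"
      using AE_d[of 0]
    proof eventually_elim
      case (elim x)
      moreover have "0 \<le> d x"
        by (simp add: d_def)
      ultimately show ?case
        by simp
    qed
  qed measurable
  have "(\<integral>x. d x \<partial>M) \<le> measure M U - measure M (B n)" for n
  proof -
    have "(\<integral>x. d x \<partial>M) \<le> (\<integral>x. cond_prob_sub U x - cond_prob_sub (B n) x \<partial>M)"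
      by (intro integral_mono_AE int_d int_diff AE_d)
    also have "\<dots> = measure M U - measure M (B n)"
      by (subst Bochner_Integration.integral_diff) (auto simp: integral_cond_prob_sub)
    finally show ?thesis .
  qed
  moreover have "(\<lambda>n. measure M U - measure M (B n)) \<longlonglongrightarrow> measure M U - measure M U"
    unfolding U_def using \<open>incseq B\<close> B
    by (intro tendsto_intros finite_Lim_measure_incseq) auto
  ultimately have "(\<integral>x. d x \<partial>M) \<le> 0"
    by (intro LIMSEQ_le_const) auto
  moreover have "(\<integral>x. d x \<partial>M) \<ge> 0"
    by (intro Bochner_Integration.integral_nonneg) (auto simp: d_def)
  ultimately have "(\<integral>x. d x \<partial>M) = 0"
    by simp
  then have "AE x in M. d x = 0"
    using int_d by (subst (asm) integral_nonneg_eq_0_iff_AE) (auto simp: d_def)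
  then show ?thesis
    unfolding U_def[symmetric] by eventually_elim (auto simp: d_def max_def split: if_splits)
qed

text \<open>
  A set \<open>B\<close> that is maximal among those of conditional probability at most \<open>h\<close> works: where
  \<open>B\<close> falls short of \<open>h\<close>, so small a piece of its complement can be added that the bound is
  preserved on a set of positive probability.
\<close>
lemma conditionally_atomless_Sierpinski:
  assumes atomless: "conditionally_atomless M F"
    and h[measurable]: "h \<in> borel_measurable F" and h01: "AE x in M. 0 \<le> h x \<and> h x \<le> 1"
  shows "\<exists>B\<in>sets M. AE x in M. cond_prob_sub B x = h x"
proof -
  define \<B> where "\<B> = {B \<in> sets M. AE x in M. cond_prob_sub B x \<le> h x}"
  have hM[measurable]: "h \<in> borel_measurable M"
    using subalg h by (rule measurable_from_subalg)
  have "AE x in M. cond_prob_sub {} x = 0"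
    using cond_prob_sub_Int[of "space M" "{}"] by simp
  then have "AE x in M. cond_prob_sub {} x \<le> h x"
    using h01 by eventually_elim auto
  then have "{} \<in> \<B>"
    by (simp add: \<B>_def)
  then obtain B where B\<B>: "B \<in> \<B>"
    and max: "\<And>C. C \<in> \<B> \<Longrightarrow> B \<subseteq> C \<Longrightarrow> measure M C = measure M B"
    using exists_measure_maximal[of \<B>] cond_prob_sub_Union_le[OF _ _ _ hM]
    by (auto simp: \<B>_def image_subset_iff)
  then have B[measurable]: "B \<in> sets M" and AE_B: "AE x in M. cond_prob_sub B x \<le> h x"
    by (auto simp: \<B>_def)
  define A where "A = space M - B"
  have [measurable]: "A \<in> sets M"
    by (simp add: A_def)
  have "A \<inter> B = {}" "A \<union> B = space M"
    using sets.sets_into_space[OF B] by (auto simp: A_def)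
  then have "AE x in M. cond_prob_sub (space M) x = cond_prob_sub A x + cond_prob_sub B x"
    using cond_prob_sub_Un[of A B] by simp
  then have AE_A: "AE x in M. cond_prob_sub A x = 1 - cond_prob_sub B x"
    using cond_prob_sub_space by eventually_elim simp
  \<comment> \<open>The deficit is treated one threshold \<open>1 / 2 ^ n\<close> at a time, to have
    a uniform amount of room for the added piece.\<close>
  have *: "AE x in M. \<not> cond_prob_sub B x + 1 / 2 ^ n \<le> h x" for n
  proof -
    have pos: "0 < 1 / (2 ^ n :: real)"
      by simp
    obtain C where C[measurable]: "C \<in> sets M" and "C \<subseteq> A"
      and AE_C: "AE x in M. 0 < cond_prob_sub A x \<longrightarrow>
        0 < cond_prob_sub C x \<and> cond_prob_sub C x \<le> cond_prob_sub A x / 2 ^ n"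
      using conditionally_atomless_small[OF atomless] \<open>A \<in> sets M\<close> by blast
    define D where "D = {x \<in> space F. cond_prob_sub B x + 1 / 2 ^ n \<le> h x}"
    have DF: "D \<in> sets F"
      unfolding D_def by measurable
    then have [measurable]: "D \<in> sets M"
      by (rule sets_subalgD)
    have AE_CD: "AE x in M. cond_prob_sub (C \<inter> D) x = indicator D x * cond_prob_sub C x"
      using DF by (intro cond_prob_sub_Int) auto
    have "AE x in M. cond_prob_sub (B \<union> (C \<inter> D)) x = cond_prob_sub B x + cond_prob_sub (C \<inter> D) x"
      using \<open>C \<subseteq> A\<close> by (intro cond_prob_sub_Un) (auto simp: A_def)
    \<comment> \<open>On \<open>D\<close> there is room for \<open>1 / 2 ^ n\<close>, and
      \<open>C\<close> adds at most that much; off \<open>D\<close> nothing is added.\<close>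
    then have "AE x in M. cond_prob_sub (B \<union> (C \<inter> D)) x \<le> h x"
      using AE_CD AE_C AE_A AE_B h01 cond_prob_sub_nonneg[OF B]
    proof eventually_elim
      case (elim x)
      show ?case
      proof (cases "x \<in> D")
        case True
        then have "cond_prob_sub B x + 1 / 2 ^ n \<le> h x"
          by (simp add: D_def)
        moreover from this have "0 < cond_prob_sub A x"
          using elim pos by linarith
        moreover have "cond_prob_sub A x / 2 ^ n \<le> 1 / 2 ^ n"
          using elim by (intro divide_right_mono) auto
        ultimately show ?thesis
          using elim True by simp
      qed (use elim in simp)
    qed
    then have "measure M (B \<union> (C \<inter> D)) = measure M B"
      by (intro max) (auto simp: \<B>_def)
    moreover have "measure M (B \<union> (C \<inter> D)) = measure M B + measure M (C \<inter> D)"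
      using \<open>C \<subseteq> A\<close> by (intro finite_measure_Union) (auto simp: A_def)
    ultimately have "(\<integral>x. cond_prob_sub (C \<inter> D) x \<partial>M) = 0"
      by (simp add: integral_cond_prob_sub)
    then have "AE x in M. cond_prob_sub (C \<inter> D) x = 0"
      using integral_cond_prob_sub(1)[of "C \<inter> D"] cond_prob_sub_nonneg[of "C \<inter> D"]
      by (subst (asm) integral_nonneg_eq_0_iff_AE) auto
    \<comment> \<open>Almost everywhere on \<open>D\<close>, \<open>B\<close> has conditional
      probability below \<open>h\<close>, hence below 1. So \<open>A\<close>, and with it
      \<open>C\<close>, has positive conditional probability there, and \<open>D\<close> must be
      null.\<close>
    then show ?thesis
      using AE_CD AE_C AE_A h01 AE_space
    proof eventually_elim
      case (elim x)
      show ?case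
      proof
        assume le: "cond_prob_sub B x + 1 / 2 ^ n \<le> h x"
        then have "x \<in> D"
          using elim by (simp add: D_def space_subalg)
        moreover have "0 < cond_prob_sub A x"
          using le elim pos by linarith
        ultimately show False
          using elim by simp
      qed
    qed
  qed
  have "AE x in M. \<forall>n. \<not> cond_prob_sub B x + 1 / 2 ^ n \<le> h x"
    using * by (subst AE_all_countable) auto
  then have "AE x in M. cond_prob_sub B x = h x"
    using AE_B
  proof eventually_elim
    case (elim x)
    show ?case
    proof (rule ccontr)
      assume "cond_prob_sub B x \<noteq> h x"
      then have "0 < h x - cond_prob_sub B x"
        using elim by simp
      then obtain n where "(1 / 2) ^ n < h x - cond_prob_sub B x"
        using real_arch_pow_inv[of "h x - cond_prob_sub B x" "1/2"] by auto
      then have "cond_prob_sub B x + 1 / 2 ^ n \<le> h x"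
        by (simp add: power_one_over)
      then show False
        using elim by blast
    qed
  qed
  then show ?thesis
    using B by blast
qed

text \<open>With \<open>a = 2 * indicator B - 1\<close>, the requirement becomes that
  \<open>B\<close> have conditional probability \<open>(1 + u / s) / 2\<close>, which lies in [0, 1]
  because \<open>u\<close> is bounded by \<open>s\<close>. The factor \<open>s\<close> is
  \<open>F\<close>-measurable and comes out of the conditional expectation.\<close>

lemma conditionally_atomless_sign:
  assumes atomless: "conditionally_atomless M F"
    and [measurable]: "u \<in> borel_measurable F" "s \<in> borel_measurable F"
    and s: "integrable M s" "\<And>x. 0 < s x" "\<And>x. \<bar>u x\<bar> \<le> s x"
  shows "\<exists>a\<in>borel_measurable M. (\<forall>x. a x = 1 \<or> a x = -1) \<and>
    (AE x in M. real_cond_exp M F (\<lambda>x. s x * a x) x = u x)"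
proof -
  have [measurable]: "s \<in> borel_measurable M"
    by (rule measurable_from_subalg[OF subalg]) fact
  have "0 \<le> (1 + u x / s x) / 2 \<and> (1 + u x / s x) / 2 \<le> 1" for x
    using s(2)[of x] s(3)[of x] by (auto simp: field_simps abs_le_iff)
  then obtain B where B[measurable]: "B \<in> sets M"
    and AE_B: "AE x in M. cond_prob_sub B x = (1 + u x / s x) / 2"
    using conditionally_atomless_Sierpinski[OF atomless, of "\<lambda>x. (1 + u x / s x) / 2"] by auto
  define a :: "'a \<Rightarrow> real" where "a x = 2 * indicator B x - 1" for x
  have [measurable]: "a \<in> borel_measurable M"
    unfolding a_def by measurable
  have a: "a x = 1 \<or> a x = -1" for x
    by (simp add: a_def indicator_def)
  have "AE x in M. real_cond_exp M F (\<lambda>x. s x * a x) x = s x * real_cond_exp M F a x"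
  proof (intro real_cond_exp_mult)
    show "integrable M (\<lambda>x. s x * a x)"
      by (rule Bochner_Integration.integrable_bound[OF s(1)])
        (auto simp: abs_mult a_def indicator_def)
  qed measurable
  moreover have "AE x in M. real_cond_exp M F a x
      = real_cond_exp M F (\<lambda>x. 2 * indicator B x) x - real_cond_exp M F (\<lambda>_. 1) x"
    unfolding a_def by (intro real_cond_exp_diff) (auto simp: emeasure_eq_measure)
  moreover have "AE x in M. real_cond_exp M F (\<lambda>x. 2 * indicator B x) x = 2 * cond_prob_sub B x"
    by (intro real_cond_exp_cmult) (auto simp: emeasure_eq_measure)
  moreover have "AE x in M. real_cond_exp M F (\<lambda>_. 1) x = 1"
    by (intro real_cond_exp_F_meas) auto
  ultimately have "AE x in M. real_cond_exp M F (\<lambda>x. s x * a x) x = u x"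
    using AE_B
  proof eventually_elim
    case (elim x)
    then show ?case
      using s(2)[of x] by (simp add: field_simps)
  qed
  then show ?thesis
    using a by (intro bexI[of _ a]) auto
qed

end

section \<open>Commonotonicity from a chain of values\<close>

text \<open>
  On the range of \<open>(\<xi>, \<eta>)\<close> the first coordinate is a nondecreasing 1-Lipschitz function of the sum of
  the coordinates; \<open>\<phi>\<close> is its McShane extension.
\<close>
lemma mono_factor_through_sum:
  fixes \<xi> \<eta> :: "'a \<Rightarrow> real"
  assumes chain: "\<And>x y. \<xi> x \<le> \<xi> y \<and> \<eta> x \<le> \<eta> y \<or> \<xi> y \<le> \<xi> x \<and> \<eta> y \<le> \<eta> x"
  shows "\<exists>\<phi>. mono \<phi> \<and> (\<forall>x. \<phi> (\<xi> x + \<eta> x) = \<xi> x)"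
proof -
  define \<phi> where "\<phi> t = (INF y. \<xi> y + max 0 (t - (\<xi> y + \<eta> y)))" for t
  \<comment> \<open>Used twice: for arbitrary \<open>t\<close> it bounds the family below, so that
    the real infimum is meaningful; for \<open>t = \<xi> x + \<eta> x\<close> it shows that the
    infimum is attained at \<open>x\<close>.\<close>
  have lip: "\<xi> x - max 0 (\<xi> x + \<eta> x - t) \<le> \<xi> y + max 0 (t - (\<xi> y + \<eta> y))" for t x y
    using chain[of x y] by (auto simp: max_def)
  have bdd: "bdd_below (range (\<lambda>y. \<xi> y + max 0 (t - (\<xi> y + \<eta> y))))" for t
    using lip[of undefined t] by (intro bdd_belowI2) auto
  have "mono \<phi>"
  proof (rule monoI)
    fix t u :: real
    assume "t \<le> u"
    then have "\<xi> y + max 0 (t - (\<xi> y + \<eta> y)) \<le> \<xi> y + max 0 (u - (\<xi> y + \<eta> y))" for y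
      by (intro add_left_mono max.mono) auto
    then show "\<phi> t \<le> \<phi> u"
      unfolding \<phi>_def by (intro cINF_mono bdd) blast+
  qed
  moreover have "\<phi> (\<xi> x + \<eta> x) = \<xi> x" for x
  proof (rule antisym)
    show "\<phi> (\<xi> x + \<eta> x) \<le> \<xi> x"
      unfolding \<phi>_def by (rule cINF_lower2[OF bdd, of x]) auto
    show "\<xi> x \<le> \<phi> (\<xi> x + \<eta> x)"
      unfolding \<phi>_def using lip[of x "\<xi> x + \<eta> x"] by (intro cINF_greatest) auto
  qed
  ultimately show ?thesis by blast
qed

text \<open>The common variable is the sum \<open>\<xi> + \<eta>\<close>, which is symmetric, so
  exchanging the roles yields \<open>\<psi>\<close>.\<close>

lemma commonotoneI:
  fixes \<xi> \<eta> :: "'a \<Rightarrow> real"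
  assumes [measurable]: "\<xi> \<in> borel_measurable M" "\<eta> \<in> borel_measurable M"
    and chain: "\<And>x y. \<xi> x \<le> \<xi> y \<and> \<eta> x \<le> \<eta> y \<or> \<xi> y \<le> \<xi> x \<and> \<eta> y \<le> \<eta> x"
  shows "commonotone M \<xi> \<eta>"
proof -
  obtain \<phi> where "mono \<phi>" "\<And>x. \<phi> (\<xi> x + \<eta> x) = \<xi> x"
    using mono_factor_through_sum[of \<xi> \<eta>] chain by blast
  moreover obtain \<psi> where "mono \<psi>" "\<And>x. \<psi> (\<xi> x + \<eta> x) = \<eta> x"
    using mono_factor_through_sum[of \<eta> \<xi>] chain by (metis add.commute)
  ultimately show ?thesis
    unfolding commonotone_def
    by (intro exI[of _ \<phi>] exI[of _ \<psi>] exI[of _ "\<lambda>x. \<xi> x + \<eta> x"]) auto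
qed

section \<open>Vertices of the dilations and dyadic scales\<close>

text \<open>The second coordinates of the vertices at scale \<open>s\<close> have absolute values
  \<open>2 * s\<close> and \<open>4 * s\<close>. If \<open>2 * s \<le> t\<close>, a vertex at scale
  \<open>t\<close> therefore dominates in both coordinates, and the sign \<open>c\<close> decides
  the order.\<close>

lemma vertices_of_dilations_chain:
  fixes s t a b c d :: real
  assumes "s = t \<or> 2 * s \<le> t \<or> 2 * t \<le> s" and "0 < s" "0 < t"
    and "a = 1 \<or> a = -1" "b = 1 \<or> b = -1" "c = 1 \<or> c = -1" "d = 1 \<or> d = -1"
  shows "4 * (s * a) \<le> 4 * (t * c) \<and> 3 * (s * a) + s * b \<le> 3 * (t * c) + t * d \<or>
    4 * (t * c) \<le> 4 * (s * a) \<and> 3 * (t * c) + t * d \<le> 3 * (s * a) + s * b"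
  using assms by auto

lemma powr_2_nested:
  fixes i j :: int
  shows "2 powr i = (2 powr j :: real) \<or> 2 * 2 powr i \<le> (2 powr j :: real) \<or>
    2 * 2 powr j \<le> (2 powr i :: real)"
proof -
  have *: "2 * 2 powr i \<le> (2 powr j :: real)" if "i < j" for i j :: int
  proof -
    have "2 * 2 powr i = (2 powr (1 + i) :: real)"
      by (simp add: powr_add)
    also have "\<dots> \<le> 2 powr j"
      using that by (intro powr_mono) linarith+
    finally show ?thesis .
  qed
  show ?thesis
    using *[of i j] *[of j i] by (cases i j rule: linorder_cases) auto
qed

text \<open>Rounding the logarithm up costs a factor of at most 2. The cutoff \<open>max 1 N\<close>
  makes the scale equal to 1 for \<open>N \<le> 1\<close>, whence the 1 in the upper bound.\<close>

lemma powr_ceiling_log2_bounds: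
  fixes N :: real
  shows "N \<le> 2 powr \<lceil>log 2 (max 1 N)\<rceil>" "2 powr \<lceil>log 2 (max 1 N)\<rceil> \<le> max (2 * N) 1"
proof -
  have m: "0 < max 1 N" by simp
  have "max 1 N = 2 powr (log 2 (max 1 N))"
    using m by simp
  also have "\<dots> \<le> 2 powr \<lceil>log 2 (max 1 N)\<rceil>"
    by (intro powr_mono) auto
  finally show "N \<le> 2 powr \<lceil>log 2 (max 1 N)\<rceil>"
    by simp
  show "2 powr \<lceil>log 2 (max 1 N)\<rceil> \<le> max (2 * N) 1"
  proof (cases "N \<le> 1")
    case False
    have "2 powr \<lceil>log 2 (max 1 N)\<rceil> \<le> 2 powr (1 + log 2 (max 1 N))"
      by (intro powr_mono) linarith+
    also have "\<dots> = 2 * max 1 N"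
      using m by (subst powr_add) simp
    finally show ?thesis
      using False by simp
  qed simp
qed

section \<open>Construction from a random dyadic scale and two random signs\<close>

theorem theorem2:
  fixes M F :: "'a measure" and f g :: "'a \<Rightarrow> real"
  assumes "prob_space M"
    and "subalgebra M F"
    and "conditionally_atomless M F"
    and "f \<in> borel_measurable F" and "integrable M f"
    and "g \<in> borel_measurable F" and "integrable M g"
  shows "\<exists>\<xi> \<eta> :: 'a \<Rightarrow> real.
    \<xi> \<in> borel_measurable M \<and> integrable M \<xi> \<and>
    \<eta> \<in> borel_measurable M \<and> integrable M \<eta> \<and>
    commonotone M \<xi> \<eta> \<and>
    (AE x in M. f x = real_cond_exp M F \<xi> x) \<and>
    (AE x in M. g x = real_cond_exp M F \<eta> x) \<and>
    (AE x in M. P1_norm (\<xi> x, \<eta> x) \<le> max (2 * P1_norm (f x, g x)) 1)"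
proof -
  interpret prob_space M by fact
  interpret finite_measure_subalgebra M F
    by unfold_locales fact
  note [measurable] = assms(4,6)
  have N[measurable]: "(\<lambda>x. P1_norm (f x, g x)) \<in> borel_measurable F"
    unfolding P1_norm_eq by measurable
  \<comment> \<open>Only powers of two are allowed, so distinct scales differ by a factor of at
    least 2, as the order of the vertices requires.\<close>
  define s where "s x = 2 powr \<lceil>log 2 (max 1 (P1_norm (f x, g x)))\<rceil>" for x
  have sF[measurable]: "s \<in> borel_measurable F"
    unfolding s_def by measurable
  have sM[measurable]: "s \<in> borel_measurable M"
    using subalg sF by (rule measurable_from_subalg)
  have s_pos: "0 < s x" for x
    by (simp add: s_def)
  have s_ge: "P1_norm (f x, g x) \<le> s x" and s_le: "s x \<le> max (2 * P1_norm (f x, g x)) 1" for x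
    unfolding s_def by (rule powr_ceiling_log2_bounds)+
  have s_int: "integrable M s"
  proof (rule Bochner_Integration.integrable_bound)
    have max_le: "max (2 * max p q) 1 \<le> 1 + 2 * (p + q)" if "0 \<le> p" "0 \<le> q" for p q :: real
      using that by (simp add: max_def)
    show "integrable M (\<lambda>x. 1 + 2 * (\<bar>f x\<bar> / 4 + \<bar>g x - 3/4 * f x\<bar>))"
      using assms by (auto intro!: Bochner_Integration.integrable_add integrable_abs
        Bochner_Integration.integrable_diff)
    show "AE x in M. norm (s x) \<le> norm (1 + 2 * (\<bar>f x\<bar> / 4 + \<bar>g x - 3/4 * f x\<bar>))"
    proof (rule AE_I2)
      fix x
      show "norm (s x) \<le> norm (1 + 2 * (\<bar>f x\<bar> / 4 + \<bar>g x - 3/4 * f x\<bar>))"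
        using s_le[of x] s_pos[of x] max_le[of "\<bar>f x\<bar> / 4" "\<bar>g x - 3/4 * f x\<bar>"]
        unfolding P1_norm_eq real_norm_def by linarith
    qed
  qed measurable
  \<comment> \<open>In the coordinates \<open>x / 4\<close> and \<open>y - 3/4 * x\<close>,
    \<open>P1_norm\<close> is the maximum norm; the bound by \<open>s\<close> splits into one bound
    for each sign.\<close>
  have "\<bar>f x / 4\<bar> \<le> s x" "\<bar>g x - 3/4 * f x\<bar> \<le> s x" for x
    using s_ge[of x] by (simp_all add: P1_norm_eq)
  then obtain a b where [measurable]: "a \<in> borel_measurable M" "b \<in> borel_measurable M"
    and a: "\<And>x. a x = 1 \<or> a x = -1" and b: "\<And>x. b x = 1 \<or> b x = -1"
    and AE_a: "AE x in M. real_cond_exp M F (\<lambda>x. s x * a x) x = f x / 4"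
    and AE_b: "AE x in M. real_cond_exp M F (\<lambda>x. s x * b x) x = g x - 3/4 * f x"
    using conditionally_atomless_sign[OF assms(3) _ sF s_int s_pos, of "\<lambda>x. f x / 4"]
      conditionally_atomless_sign[OF assms(3) _ sF s_int s_pos, of "\<lambda>x. g x - 3/4 * f x"]
    by auto
  have int: "integrable M (\<lambda>x. s x * a x)" "integrable M (\<lambda>x. s x * b x)"
  proof -
    have "\<bar>a x\<bar> = 1" "\<bar>b x\<bar> = 1" for x
      using a[of x] b[of x] by auto
    then show "integrable M (\<lambda>x. s x * a x)" "integrable M (\<lambda>x. s x * b x)"
      by (auto intro!: Bochner_Integration.integrable_bound[OF s_int] simp: abs_mult)
  qed
  \<comment> \<open>These formulas invert that change of coordinates, applied to the corner
    \<open>(s x * a x, s x * b x)\<close> of a square.\<close>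
  define \<xi> where "\<xi> x = 4 * (s x * a x)" for x
  define \<eta> where "\<eta> x = 3 * (s x * a x) + s x * b x" for x
  have meas: "\<xi> \<in> borel_measurable M" "\<eta> \<in> borel_measurable M"
    unfolding \<xi>_def \<eta>_def by measurable
  moreover have "integrable M \<xi>" "integrable M \<eta>"
    unfolding \<xi>_def \<eta>_def using int by auto
  moreover have "commonotone M \<xi> \<eta>"
  proof (rule commonotoneI[OF meas])
    fix x y
    show "\<xi> x \<le> \<xi> y \<and> \<eta> x \<le> \<eta> y \<or> \<xi> y \<le> \<xi> x \<and> \<eta> y \<le> \<eta> x"
      unfolding \<xi>_def \<eta>_def using s_pos a b
      by (intro vertices_of_dilations_chain) (auto simp: s_def powr_2_nested)
  qed
  moreover have "AE x in M. f x = real_cond_exp M F \<xi> x"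
  proof -
    have "AE x in M. real_cond_exp M F \<xi> x = 4 * real_cond_exp M F (\<lambda>x. s x * a x) x"
      unfolding \<xi>_def using int by (intro real_cond_exp_cmult) auto
    then show ?thesis
      using AE_a by eventually_elim simp
  qed
  moreover have "AE x in M. g x = real_cond_exp M F \<eta> x"
  proof -
    have "AE x in M. real_cond_exp M F \<eta> x =
        real_cond_exp M F (\<lambda>x. 3 * (s x * a x)) x + real_cond_exp M F (\<lambda>x. s x * b x) x"
      unfolding \<eta>_def using int by (intro real_cond_exp_add) auto
    moreover have "AE x in M. real_cond_exp M F (\<lambda>x. 3 * (s x * a x)) x
        = 3 * real_cond_exp M F (\<lambda>x. s x * a x) x"
      using int by (intro real_cond_exp_cmult) auto
    ultimately show ?thesis
      using AE_a AE_b by eventually_elim simp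
  qed
  moreover have "P1_norm (\<xi> x, \<eta> x) \<le> max (2 * P1_norm (f x, g x)) 1" for x
  proof -
    have "P1_norm (\<xi> x, \<eta> x) = s x"
      using a[of x] b[of x] s_pos[of x] unfolding P1_norm_eq by (auto simp: \<xi>_def \<eta>_def)
    then show ?thesis
      using s_le[of x] by simp
  qed
  ultimately show ?thesis
    by blast
qed

end
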